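(* Let $f:\mathbb{R}\to\mathbb{R}$ be a locally integrable function (a fixed pointwise representative of an element of $L^1_{\mathrm{loc}}(\mathbb{R})$) and let $x_0\in\mathbb{R}$. If the second symmetric Borel derivative $SBD^{2}f(x_0)$ exists finitely, say $SBD^{2}f(x_0)=M$, then for every even $\phi\in\mathcal{D}(\mathbb{R})$, \[ \lim_{\varepsilon\to 0^+}\langle T_f'',\phi_{x_0,\varepsilon}\rangle =M\int_{\mathbb{R}}\phi(u)\,du. \] In particular, $T_f''$ has symmetric distributional point value $M$ at $x_0$.
   Context: $\mathcal{D}(\mathbb{R})=C_c^\infty(\mathbb{R})$ and $\mathcal{D}'(\mathbb{R})$ is the space of distributions. For $f\in L^1_{\mathrm{loc}}(\mathbb{R})$, $T_f\in\mathcal{D}'(\mathbb{R})$ is the regular distribution $\langle T_f,\psi\rangle=\int_{\mathbb{R}} f\psi\,dx$, and its second distributional derivative is $\langle T_f'',\psi\rangle=\langle T_f,\psi''\rangle$. For $\phi\in\mathcal{D}(\mathbb{R})$ and $\varepsilon>0$, $\phi_{x_0,\varepsilon}(x)=\varepsilon^{-1}\phi\left(\frac{x-x_0}{\varepsilon}\right)$. The second symmetric Borel derivative of $f$ at $x_0$ is \[ SBD^{2}f(x_0)=\lim_{h\to 0^+}\frac{1}{h}\int_0^h \frac{f(x_0+t)+f(x_0-t)-2f(x_0)}{t^2}\,dt, \] whenever this limit exists finitely (in particular the integrand is Lebesgue integrable on $(0,h)$ for all sufficiently small $h>0$). A distribution $T$ has symmetric distributional point value $M\in\mathbb{R}$ at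 $x_0$ if $\lim_{\varepsilon\to 0^+}\langle T,\phi_{x_0,\varepsilon}\rangle=M\int_{\mathbb{R}}\phi(u)\,du$ for every even $\phi\in\mathcal{D}(\mathbb{R})$. *)

theory Defs
  imports "HOL-Analysis.Analysis"
begin

section \<open>Test functions and distributions on the real line\<close>

definition test_functions :: "(real \<Rightarrow> real) set"  (\<open>\<D>\<close>) where
  "\<D> = {\<phi>. (\<forall>k x. (deriv ^^ k) \<phi> field_differentiable (at x)) \<and>
           compact (closure (support_on UNIV \<phi>))}"

definition converges_in_D :: "(nat \<Rightarrow> real \<Rightarrow> real) \<Rightarrow> (real \<Rightarrow> real) \<Rightarrow> bool" where
  "converges_in_D \<phi>s \<phi> \<longleftrightarrow>
     (\<exists>K. compact K \<and> (\<forall>n. support_on UNIV (\<phi>s n) \<subseteq> K)) \<and>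
     (\<forall>k. uniform_limit UNIV (\<lambda>n. (deriv ^^ k) (\<phi>s n)) ((deriv ^^ k) \<phi>) sequentially)"

text \<open>A distribution is represented by a functional on all functions, of which only the
  restriction to \<open>\<D>\<close> is relevant. Continuity with respect to the usual topology of \<open>\<D>\<close>
  is sequential continuity.\<close>

definition distribution :: "((real \<Rightarrow> real) \<Rightarrow> real) \<Rightarrow> bool" where
  "distribution T \<longleftrightarrow>
     (\<forall>\<phi>\<in>\<D>. \<forall>\<psi>\<in>\<D>. T (\<lambda>x. \<phi> x + \<psi> x) = T \<phi> + T \<psi>) \<and>
     (\<forall>c. \<forall>\<phi>\<in>\<D>. T (\<lambda>x. c * \<phi> x) = c * T \<phi>) \<and>
     (\<forall>\<phi>s. \<forall>\<phi>\<in>\<D>. (\<forall>n. \<phi>s n \<in> \<D>) \<longrightarrow> converges_in_D \<phi>s \<phi> \<longrightarrow>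
        (\<lambda>n. T (\<phi>s n)) \<longlonglongrightarrow> T \<phi>)"

definition locally_integrable :: "(real \<Rightarrow> real) \<Rightarrow> bool" where
  "locally_integrable f \<longleftrightarrow> (\<forall>K. compact K \<longrightarrow> set_integrable lebesgue K f)"

definition regular_distribution :: "(real \<Rightarrow> real) \<Rightarrow> (real \<Rightarrow> real) \<Rightarrow> real" where
  "regular_distribution f \<psi> = (LINT x|lebesgue. f x * \<psi> x)"

definition second_dist_deriv ::
  "((real \<Rightarrow> real) \<Rightarrow> real) \<Rightarrow> (real \<Rightarrow> real) \<Rightarrow> real" where
  "second_dist_deriv T \<psi> = T (deriv (deriv \<psi>))"

section \<open>Point values and the second symmetric Borel derivative\<close>

definition rescale :: "(real \<Rightarrow> real) \<Rightarrow> real \<Rightarrow> real \<Rightarrow> real \<Rightarrow> real" where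
  "rescale \<phi> x0 \<epsilon> = (\<lambda>x. inverse \<epsilon> * \<phi> ((x - x0) / \<epsilon>))"

definition has_symmetric_point_value ::
  "((real \<Rightarrow> real) \<Rightarrow> real) \<Rightarrow> real \<Rightarrow> real \<Rightarrow> bool" where
  "has_symmetric_point_value T M x0 \<longleftrightarrow>
     distribution T \<and>
     (\<forall>\<phi>\<in>\<D>. (\<forall>u. \<phi> (- u) = \<phi> u) \<longrightarrow>
        ((\<lambda>\<epsilon>. T (rescale \<phi> x0 \<epsilon>)) \<longlongrightarrow> M * (LINT u|lebesgue. \<phi> u)) (at_right 0))"

definition symmetric_quotient2 :: "(real \<Rightarrow> real) \<Rightarrow> real \<Rightarrow> real \<Rightarrow> real" where
  "symmetric_quotient2 f x0 t = (f (x0 + t) + f (x0 - t) - 2 * f x0) / t\<^sup>2"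

text \<open>Integrability is demanded explicitly because the Bochner integral of a
  non-integrable function is 0 by convention.\<close>

definition has_SBD2 :: "(real \<Rightarrow> real) \<Rightarrow> real \<Rightarrow> real \<Rightarrow> bool" where
  "has_SBD2 f M x0 \<longleftrightarrow>
     (\<forall>\<^sub>F h in at_right 0. set_integrable lebesgue {0<..<h} (symmetric_quotient2 f x0)) \<and>
     ((\<lambda>h. (1 / h) * (LINT t:{0<..<h}|lebesgue. symmetric_quotient2 f x0 t)) \<longlongrightarrow> M)
       (at_right 0)"

end

theory Submission
  imports Defs
begin

text \<open>
  With \<open>t = x - x\<^sub>0\<close> and \<open>\<phi>\<close> even, folding the pairing onto \<open>t \<ge> 0\<close> and using
  \<open>\<integral>\<^sub>0\<^sup>\<infinity> \<phi>'' = -\<phi>'(0) = 0\<close> to insert \<open>-2 f(x\<^sub>0)\<close> gives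
  \<open>\<epsilon>\<inverse> \<integral> q(t) k(t/\<epsilon>) dt\<close> over \<open>[0, R\<epsilon>]\<close>, where \<open>q\<close> is the symmetric quotient and
  \<open>k(s) = s\<^sup>2 \<phi>''(s)\<close>. Here \<open>q\<close> need not be absolutely controlled, only its averages converge
  to \<open>M\<close>. Since \<open>k\<close> is Lipschitz, it is a difference of two monotone functions, and the second
  mean value theorem bounds the integral of \<open>(q - M) k(\<cdot>/\<epsilon>)\<close> by integrals of \<open>q - M\<close> over
  subintervals of \<open>[0, R\<epsilon>]\<close>, which are \<open>o(\<epsilon>)\<close>. Finally \<open>\<integral> s\<^sup>2 \<phi>''(s) ds = 2 \<integral> \<phi>\<close>.
\<close>

section \<open>Averages against a Lipschitz weight\<close>

text \<open>The second mean value theorem turns the weighted integral into \<open>g a\<close> times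
  an initial integral of \<open>p\<close> plus \<open>g b\<close> times a final one. The final
  integral is a difference of two initial ones, hence the factor 2. Only signed integrals of
  \<open>p\<close> enter, so cancellation in \<open>p\<close> is kept.\<close>

lemma abs_integral_monotone_weight_le:
  fixes p g :: "real \<Rightarrow> real"
  assumes p: "p integrable_on {a..b}" and ab: "a \<le> b"
    and mono: "\<And>x y. \<lbrakk>a \<le> x; x \<le> y; y \<le> b\<rbrakk> \<Longrightarrow> g x \<le> g y"
    and bound: "\<And>c. c \<in> {a..b} \<Longrightarrow> \<bar>integral {a..c} p\<bar> \<le> B"
  shows "(\<lambda>x. g x * p x) integrable_on {a..b}"
    and "\<bar>integral {a..b} (\<lambda>x. g x * p x)\<bar> \<le> (\<bar>g a\<bar> + 2 * \<bar>g b\<bar>) * B"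
proof -
  obtain c where c: "c \<in> {a..b}"
    and I: "((\<lambda>x. g x * p x) has_integral (g a * integral {a..c} p + g b * integral {c..b} p)) {a..b}"
    using second_mean_value_theorem_full[where g = g, OF p ab mono] by blast
  show "(\<lambda>x. g x * p x) integrable_on {a..b}"
    using I by blast
  have "integral {a..c} p + integral {c..b} p = integral {a..b} p"
    using c p by (intro Henstock_Kurzweil_Integration.integral_combine) auto
  then have cb: "\<bar>integral {c..b} p\<bar> \<le> 2 * B"
    using bound[OF c] bound[of b] ab by auto
  have "\<bar>g a * integral {a..c} p + g b * integral {c..b} p\<bar> \<le> \<bar>g a\<bar> * B + \<bar>g b\<bar> * (2 * B)"
    using bound[OF c] cb
    by (intro order_trans[OF abs_triangle_ineq] add_mono) (auto simp: abs_mult intro: mult_left_mono)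
  then show "\<bar>integral {a..b} (\<lambda>x. g x * p x)\<bar> \<le> (\<bar>g a\<bar> + 2 * \<bar>g b\<bar>) * B"
    using integral_unique[OF I] by (simp add: algebra_simps)
qed

text \<open>The end values on \<open>{0..R * \<epsilon>}\<close> of the monotone parts of
  \<open>k (t / \<epsilon>)\<close> do not depend on \<open>\<epsilon>\<close>. Hence the error is a
  fixed constant times a bound for the integrals of \<open>q - M\<close> over \<open>{0..c}\<close>
  with \<open>c \<le> R * \<epsilon>\<close>, which is \<open>o(\<epsilon>)\<close>.\<close>

lemma tendsto_integral_lipschitz_weight:
  fixes q k :: "real \<Rightarrow> real"
  assumes int: "\<forall>\<^sub>F h in at_right 0. q integrable_on {0..h}"
    and lim: "((\<lambda>h. integral {0..h} q / h) \<longlongrightarrow> M) (at_right 0)"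
    and k: "L-lipschitz_on {0..R} k" and R: "R > 0"
  shows "((\<lambda>\<epsilon>. integral {0..R * \<epsilon>} (\<lambda>t. q t * k (t / \<epsilon>)) / \<epsilon>) \<longlongrightarrow> M * integral {0..R} k) (at_right 0)"
proof (rule tendstoI)
  fix e :: real assume e: "e > 0"
  have L: "L \<ge> 0"
    using k by (rule lipschitz_on_nonneg)
  \<comment> \<open>The terms are the end-value factors of the two monotone weights
    \<open>g1\<close> and \<open>g2\<close> below: \<open>g1\<close> runs from \<open>k 0\<close> to
    \<open>k R + L * R\<close>, and \<open>g2\<close> from 0 to \<open>L * R\<close>. The summand 1
    makes \<open>C\<close> positive, so that \<open>\<eta>\<close> can be chosen with
    \<open>C * \<eta> * (R * \<epsilon>) = \<epsilon> * e / 3\<close>.\<close>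
  define C where "C = \<bar>k 0\<bar> + 2 * \<bar>k R + L * R\<bar> + 2 * L * R + 1"
  have C: "C > 0"
    using L R by (auto simp: C_def intro!: add_nonneg_pos add_nonneg_nonneg)
  define \<eta> where "\<eta> = e / (3 * C * R)"
  have \<eta>: "\<eta> > 0"
    using e C R by (simp add: \<eta>_def)
  have "\<forall>\<^sub>F h in at_right 0. q integrable_on {0..h} \<and> dist (integral {0..h} q / h) M < \<eta>"
    using int tendstoD[OF lim \<eta>] by (rule eventually_conj)
  then obtain b where b: "b > 0"
    "\<And>h. 0 < h \<Longrightarrow> h < b \<Longrightarrow> q integrable_on {0..h} \<and> dist (integral {0..h} q / h) M < \<eta>"
    unfolding eventually_at_right_field by auto
  have "\<forall>\<^sub>F \<epsilon> in at_right 0. \<epsilon> < b / R"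
    using b R by (intro eventually_at_right_less eventually_at_rightI[of 0 "b / R"]) auto
  moreover have "\<forall>\<^sub>F \<epsilon> in at_right 0. (\<epsilon>::real) > 0"
    by (rule eventually_at_right_less)
  ultimately show "\<forall>\<^sub>F \<epsilon> in at_right 0.
      dist (integral {0..R * \<epsilon>} (\<lambda>t. q t * k (t / \<epsilon>)) / \<epsilon>) (M * integral {0..R} k) < e"
  proof eventually_elim
    case (elim \<epsilon>)
    define \<delta> where "\<delta> = R * \<epsilon>"
    have \<delta>: "0 < \<delta>" "\<delta> < b"
      using elim R by (auto simp: \<delta>_def field_simps)
    define p where "p = (\<lambda>t. q t - M)"
    have qi: "q integrable_on {0..\<delta>}"
      using b \<delta> by auto
    have pi: "p integrable_on {0..\<delta>}"
      unfolding p_def using qi by (intro integrable_diff) auto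
    \<comment> \<open>The average of \<open>p\<close> over \<open>{0..c}\<close> is at most
      \<open>\<eta>\<close> in absolute value for every \<open>0 < c < b\<close>; multiplying by
      \<open>c \<le> \<delta>\<close> gives a bound uniform in \<open>c\<close>.\<close>
    have bound: "\<bar>integral {0..c} p\<bar> \<le> \<eta> * \<delta>" if c: "c \<in> {0..\<delta>}" for c
    proof (cases "c = 0")
      case True
      then show ?thesis using \<eta> \<delta> by simp
    next
      case False
      with c have c': "0 < c" "c < b" "c \<le> \<delta>"
        using \<delta> by auto
      have "integral {0..c} p = integral {0..c} q - M * c"
        unfolding p_def using b(2)[OF c'(1,2)] c' by (subst integral_diff) auto
      also have "\<bar>\<dots>\<bar> = \<bar>integral {0..c} q / c - M\<bar> * c"
        using c' by (subst abs_mult_pos) (simp_all add: left_diff_distrib)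
      also have "\<dots> \<le> \<eta> * \<delta>"
        using b(2)[OF c'(1,2)] c' \<eta> by (intro mult_mono) (auto simp: dist_real_def)
      finally show ?thesis .
    qed
    \<comment> \<open>Adding the slope \<open>L\<close> makes the Lipschitz function nondecreasing,
      so \<open>g1 - g2\<close> writes the weight as a difference of monotone functions.\<close>
    define g1 where "g1 = (\<lambda>t. k (t / \<epsilon>) + L * (t / \<epsilon>))"
    define g2 where "g2 = (\<lambda>t. L * (t / \<epsilon>))"
    have mono1: "g1 x \<le> g1 y" if "0 \<le> x" "x \<le> y" "y \<le> \<delta>" for x y
    proof -
      have "x / \<epsilon> \<in> {0..R}" "y / \<epsilon> \<in> {0..R}" "x / \<epsilon> \<le> y / \<epsilon>"
        using that elim by (auto simp: \<delta>_def field_simps)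
      then have "\<bar>k (x / \<epsilon>) - k (y / \<epsilon>)\<bar> \<le> L * (y / \<epsilon> - x / \<epsilon>)"
        using lipschitz_onD[OF k, of "x / \<epsilon>" "y / \<epsilon>"] by (simp add: dist_real_def)
      then show ?thesis
        by (simp add: g1_def algebra_simps)
    qed
    have mono2: "g2 x \<le> g2 y" if "0 \<le> x" "x \<le> y" "y \<le> \<delta>" for x y
      using that elim L by (auto simp: g2_def intro!: mult_left_mono divide_right_mono)
    have \<delta>\<epsilon>: "\<delta> / \<epsilon> = R"
      using elim by (simp add: \<delta>_def)
    note I1 = abs_integral_monotone_weight_le[where g = g1, OF pi less_imp_le[OF \<delta>(1)] mono1 bound]
    note I2 = abs_integral_monotone_weight_le[where g = g2, OF pi less_imp_le[OF \<delta>(1)] mono2 bound]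
    have ki: "(k has_integral integral {0..R} k) (cbox 0 R)"
      using integrable_continuous_real[OF lipschitz_on_continuous_on[OF k]] by (simp add: has_integral_integral)
    have kI: "((\<lambda>t. k (t / \<epsilon>)) has_integral \<epsilon> * integral {0..R} k) {0..\<delta>}"
      using has_integral_affinity'[OF ki, of "inverse \<epsilon>" 0] elim
      by (simp add: \<delta>_def field_simps)
    have eq: "q t * k (t / \<epsilon>) = g1 t * p t - g2 t * p t + M * k (t / \<epsilon>)" for t
      by (simp add: g1_def g2_def p_def algebra_simps)
    have "((\<lambda>t. q t * k (t / \<epsilon>)) has_integral
        integral {0..\<delta>} (\<lambda>t. g1 t * p t) - integral {0..\<delta>} (\<lambda>t. g2 t * p t) + M * (\<epsilon> * integral {0..R} k)) {0..\<delta>}"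
      unfolding eq using I1(1) I2(1) kI
      by (intro has_integral_add has_integral_diff has_integral_mult_right integrable_integral) auto
    then have "integral {0..\<delta>} (\<lambda>t. q t * k (t / \<epsilon>)) - \<epsilon> * (M * integral {0..R} k)
        = integral {0..\<delta>} (\<lambda>t. g1 t * p t) - integral {0..\<delta>} (\<lambda>t. g2 t * p t)"
      by (simp add: integral_unique)
    also have "\<bar>\<dots>\<bar> \<le> (\<bar>g1 0\<bar> + 2 * \<bar>g1 \<delta>\<bar>) * (\<eta> * \<delta>) + (\<bar>g2 0\<bar> + 2 * \<bar>g2 \<delta>\<bar>) * (\<eta> * \<delta>)"
      using I1(2) I2(2) by linarith
    also have "\<dots> \<le> C * (\<eta> * \<delta>)"
      using L R \<eta> \<delta> unfolding distrib_right[symmetric]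
      by (intro mult_right_mono) (auto simp: g1_def g2_def \<delta>\<epsilon> C_def simp del: times_divide_eq_right)
    also have "\<dots> = \<epsilon> * (e / 3)"
      using C R by (simp add: \<eta>_def \<delta>_def)
    also have "\<dots> < \<epsilon> * e"
      using e elim by simp
    finally have *: "\<bar>integral {0..\<delta>} (\<lambda>t. q t * k (t / \<epsilon>)) - \<epsilon> * (M * integral {0..R} k)\<bar> < \<epsilon> * e" .
    have "integral {0..\<delta>} (\<lambda>t. q t * k (t / \<epsilon>)) / \<epsilon> - M * integral {0..R} k
        = (integral {0..\<delta>} (\<lambda>t. q t * k (t / \<epsilon>)) - \<epsilon> * (M * integral {0..R} k)) / \<epsilon>"
      using elim by (simp add: field_simps)
    then show ?case
      using * elim by (simp add: dist_real_def abs_divide pos_divide_less_eq \<delta>_def mult.commute)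
  qed
qed

section \<open>Test functions\<close>

lemma test_function_DERIV:
  assumes "\<phi> \<in> \<D>" shows "(\<phi> has_real_derivative deriv \<phi> x) (at x)"
proof -
  have "(deriv ^^ 0) \<phi> field_differentiable (at x)"
    using assms unfolding test_functions_def by blast
  then show ?thesis
    by (simp add: DERIV_deriv_iff_field_differentiable)
qed

lemma continuous_on_test_function:
  assumes "\<phi> \<in> \<D>" shows "continuous_on S \<phi>"
  using DERIV_continuous_on[of S \<phi> "deriv \<phi>"] test_function_DERIV[OF assms]
  by (auto intro: has_field_derivative_at_within)

text \<open>Off \<open>K\<close> the function vanishes on a whole neighbourhood. A fixed closed
  \<open>K\<close> in place of the support lets the same set serve for all higher derivatives and
  for whole sequences of functions.\<close>

lemma deriv_eq_0_outside_closed: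
  assumes K: "closed K" and 0: "\<And>x. x \<notin> K \<Longrightarrow> \<phi> x = 0" and x: "x \<notin> K"
  shows "deriv \<phi> x = (0::'a::real_normed_field)"
proof -
  have "\<forall>\<^sub>F y in nhds x. \<phi> y = 0"
    using eventually_nhds_in_open[of "- K" x] K x 0
    by (auto simp: open_Compl elim!: eventually_mono)
  then have "deriv \<phi> x = deriv (\<lambda>_. 0) x"
    by (intro deriv_cong_ev) auto
  then show ?thesis by simp
qed

lemma test_function_support:
  assumes "\<phi> \<in> \<D>"
  obtains K where "compact K" "\<And>x. x \<notin> K \<Longrightarrow> \<phi> x = 0"
proof
  show "compact (closure (support_on UNIV \<phi>))"
    using assms by (simp add: test_functions_def)
  show "\<phi> x = 0" if "x \<notin> closure (support_on UNIV \<phi>)" for x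
    using that closure_subset[of "support_on UNIV \<phi>"] by (auto simp: in_support_on)
qed

lemma test_function_bounded_support:
  assumes "\<phi> \<in> \<D>"
  obtains R where "R > 0" "\<And>x. x \<notin> {-R..R} \<Longrightarrow> \<phi> x = 0"
proof -
  obtain K where K: "compact K" "\<And>x. x \<notin> K \<Longrightarrow> \<phi> x = 0"
    using test_function_support[OF assms] by blast
  obtain B where B: "B > 0" "\<And>x. x \<in> K \<Longrightarrow> norm x \<le> B"
    using compact_imp_bounded[OF K(1)] by (auto simp: bounded_pos)
  have "\<phi> x = 0" if "x \<notin> {-B..B}" for x
    using B(2)[of x] K(2)[of x] that by (cases "x \<in> K") (auto simp: abs_le_iff)
  with B(1) show ?thesis by (rule that)
qed

lemma deriv_test_function:
  assumes "\<phi> \<in> \<D>" shows "deriv \<phi> \<in> \<D>"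
proof -
  have diff: "(deriv ^^ k) \<phi> field_differentiable (at x)" for k x
    using assms by (simp add: test_functions_def)
  have "(deriv ^^ k) (deriv \<phi>) field_differentiable (at x)" for k x
    using diff[of "Suc k" x] by (simp add: funpow_swap1)
  moreover obtain K where K: "compact K" "\<And>x. x \<notin> K \<Longrightarrow> \<phi> x = 0"
    using test_function_support[OF assms] by blast
  then have "support_on UNIV (deriv \<phi>) \<subseteq> K"
    using deriv_eq_0_outside_closed[of K \<phi>] compact_imp_closed[OF K(1)]
    by (metis in_support_on subsetI)
  then have "compact (closure (support_on UNIV (deriv \<phi>)))"
    using K(1) by (meson bounded_subset compact_closure compact_imp_bounded)
  ultimately show ?thesis
    by (simp add: test_functions_def)
qed

text \<open>Each derivative contributes one factor \<open>inverse \<epsilon>\<close> beyond the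
  normalising one. At \<open>\<epsilon> = 0\<close> both sides vanish because
  \<open>inverse 0 = 0\<close>.\<close>

lemma deriv_deriv_rescale:
  assumes "\<phi> \<in> \<D>"
  shows "deriv (deriv (rescale \<phi> x0 \<epsilon>)) = (\<lambda>x. inverse \<epsilon> ^ 3 * deriv (deriv \<phi>) ((x - x0) / \<epsilon>))"
proof -
  have chain: "((\<lambda>x. c * \<psi> ((x - x0) / \<epsilon>)) has_real_derivative c * inverse \<epsilon> * deriv \<psi> ((x - x0) / \<epsilon>)) (at x)"
    if "\<psi> \<in> \<D>" for \<psi> c x
  proof -
    have "((\<lambda>x. (x - x0) / \<epsilon>) has_real_derivative inverse \<epsilon>) (at x)"
      unfolding divide_inverse by (auto intro!: derivative_eq_intros)
    then have "((\<lambda>x. \<psi> ((x - x0) / \<epsilon>)) has_real_derivative deriv \<psi> ((x - x0) / \<epsilon>) * inverse \<epsilon>) (at x)"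
      by (rule DERIV_chain2[where f = \<psi>, OF test_function_DERIV[OF that]])
    from DERIV_cmult[OF this, of c] show ?thesis
      by (simp add: mult_ac)
  qed
  have 1: "deriv (rescale \<phi> x0 \<epsilon>) = (\<lambda>x. inverse \<epsilon> * inverse \<epsilon> * deriv \<phi> ((x - x0) / \<epsilon>))"
    unfolding rescale_def by (intro ext DERIV_imp_deriv chain assms)
  show ?thesis
    unfolding 1
    by (intro ext DERIV_imp_deriv DERIV_cong[OF chain[OF deriv_test_function[OF assms]]])
       (simp add: power3_eq_cube)
qed

text \<open>The parameter \<open>c\<close> treats both parities at once: \<open>c = 1\<close> shows
  that the derivative of an even function is odd, \<open>c = - 1\<close> that the derivative of an
  odd one is even.\<close>

lemma deriv_minus_arg:
  fixes \<phi> :: "real \<Rightarrow> real"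
  assumes D: "\<And>x. (\<phi> has_real_derivative deriv \<phi> x) (at x)" and "\<And>u. \<phi> (- u) = c * \<phi> u"
  shows "deriv \<phi> (- u) = - c * deriv \<phi> u"
proof -
  have "((\<lambda>u. \<phi> (- u)) has_real_derivative - deriv \<phi> (- u)) (at u)"
    using DERIV_chain2[where f = \<phi> and g = uminus, OF D[of "- u"] DERIV_minus[OF DERIV_ident]] by simp
  moreover have "((\<lambda>u. \<phi> (- u)) has_real_derivative c * deriv \<phi> u) (at u)"
    unfolding assms(2) by (intro DERIV_cmult D)
  ultimately show ?thesis
    using DERIV_unique by fastforce
qed

section \<open>Regular distributions\<close>

text \<open>A continuous \<open>\<psi>\<close> is bounded on \<open>K\<close>, so a multiple of
  \<open>indicator K x * f x\<close> dominates the product. Mere continuity allows the use for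
  shifted and rescaled second derivatives without first placing them in \<open>\<D>\<close>.\<close>

lemma integrable_mult_continuous_compact_support:
  assumes f: "locally_integrable f" and K: "compact K"
    and \<psi>: "continuous_on UNIV \<psi>" "\<And>x. x \<notin> K \<Longrightarrow> \<psi> x = 0"
  shows "integrable lebesgue (\<lambda>x. f x * \<psi> x)"
proof -
  have fK: "integrable lebesgue (\<lambda>x. indicator K x * f x)"
    using f K by (simp add: locally_integrable_def set_integrable_def)
  have "compact (\<psi> ` K)"
    using K \<psi>(1) by (intro compact_continuous_image) (auto intro: continuous_on_subset)
  then have "bounded (\<psi> ` K)"
    by (rule compact_imp_bounded)
  then obtain B where B: "\<And>x. x \<in> K \<Longrightarrow> norm (\<psi> x) \<le> B"
    unfolding bounded_iff by blast
  have [measurable]: "\<psi> \<in> borel_measurable lebesgue"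
    using \<psi>(1) by (intro measurable_completion) (auto intro: borel_measurable_continuous_onI)
  have eq: "(\<lambda>x. f x * \<psi> x) = (\<lambda>x. (indicator K x * f x) * \<psi> x)"
    using \<psi>(2) by (force simp: indicator_def)
  have [measurable]: "(\<lambda>x. indicator K x * f x) \<in> borel_measurable lebesgue"
    using fK by simp
  show ?thesis
    unfolding eq
  proof (rule Bochner_Integration.integrable_bound[OF integrable_mult_left[OF fK, of B]])
    show "AE x in lebesgue. norm (indicator K x * f x * \<psi> x) \<le> norm (indicator K x * f x * B)"
      using order_trans[OF B abs_ge_self]
      by (intro AE_I2) (auto simp: indicator_def abs_mult intro!: mult_left_mono)
  qed measurable
qed

lemma integrable_mult_test_function:
  assumes "locally_integrable f" "\<psi> \<in> \<D>"
  shows "integrable lebesgue (\<lambda>x. f x * \<psi> x)"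
proof -
  obtain K where K: "compact K" "\<And>x. x \<notin> K \<Longrightarrow> \<psi> x = 0"
    using test_function_support[OF assms(2)] by blast
  show ?thesis
    using K(2)
    by (rule integrable_mult_continuous_compact_support[OF assms(1) K(1) continuous_on_test_function[OF assms(2)]])
qed

text \<open>Linearity comes from that of \<open>deriv\<close>; sequential continuity follows by
  dominated convergence, since second derivatives converge uniformly with supports in a common
  compact set.\<close>

lemma distribution_second_dist_deriv_regular:
  assumes f: "locally_integrable f"
  shows "distribution (second_dist_deriv (regular_distribution f))"
  unfolding distribution_def
proof (intro conjI ballI allI impI)
  note D = test_function_DERIV and D' = deriv_test_function
  note int = integrable_mult_test_function[OF f D'[OF D']]
  show "second_dist_deriv (regular_distribution f) (\<lambda>x. \<phi> x + \<psi> x) =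
      second_dist_deriv (regular_distribution f) \<phi> + second_dist_deriv (regular_distribution f) \<psi>"
    if \<phi>: "\<phi> \<in> \<D>" and \<psi>: "\<psi> \<in> \<D>" for \<phi> \<psi>
  proof -
    have "deriv (\<lambda>x. \<phi> x + \<psi> x) = (\<lambda>x. deriv \<phi> x + deriv \<psi> x)"
      by (intro ext DERIV_imp_deriv DERIV_add D \<phi> \<psi>)
    moreover have "deriv (\<lambda>x. deriv \<phi> x + deriv \<psi> x) = (\<lambda>x. deriv (deriv \<phi>) x + deriv (deriv \<psi>) x)"
      by (intro ext DERIV_imp_deriv DERIV_add D D' \<phi> \<psi>)
    ultimately show ?thesis
      using int[OF \<phi>] int[OF \<psi>]
      by (simp add: second_dist_deriv_def regular_distribution_def distrib_left)
  qed
  show "second_dist_deriv (regular_distribution f) (\<lambda>x. c * \<phi> x) =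
      c * second_dist_deriv (regular_distribution f) \<phi>" if \<phi>: "\<phi> \<in> \<D>" for c \<phi>
  proof -
    have "deriv (\<lambda>x. c * \<phi> x) = (\<lambda>x. c * deriv \<phi> x)"
      by (intro ext DERIV_imp_deriv DERIV_cmult D \<phi>)
    moreover have "deriv (\<lambda>x. c * deriv \<phi> x) = (\<lambda>x. c * deriv (deriv \<phi>) x)"
      by (intro ext DERIV_imp_deriv DERIV_cmult D D' \<phi>)
    ultimately show ?thesis
      by (simp add: second_dist_deriv_def regular_distribution_def mult.left_commute)
  qed
  show "(\<lambda>n. second_dist_deriv (regular_distribution f) (\<phi>s n)) \<longlonglongrightarrow>
      second_dist_deriv (regular_distribution f) \<phi>"
    if \<phi>: "\<phi> \<in> \<D>" and \<phi>s: "\<forall>n. \<phi>s n \<in> \<D>" and conv: "converges_in_D \<phi>s \<phi>" for \<phi>s \<phi>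
  proof -
    obtain K where K: "compact K" "\<And>n. support_on UNIV (\<phi>s n) \<subseteq> K"
      using conv unfolding converges_in_D_def by blast
    have "\<phi>s n x = 0" if "x \<notin> K" for n x
      using K(2)[of n] that by (auto simp: in_support_on)
    then have zero: "deriv (deriv (\<phi>s n)) x = 0" if "x \<notin> K" for n x
      using that compact_imp_closed[OF K(1)] by (intro deriv_eq_0_outside_closed[of K]) blast+
    have "uniform_limit UNIV (\<lambda>n. (deriv ^^ 2) (\<phi>s n)) ((deriv ^^ 2) \<phi>) sequentially"
      using conv unfolding converges_in_D_def by blast
    then have ul: "uniform_limit UNIV (\<lambda>n. deriv (deriv (\<phi>s n))) (deriv (deriv \<phi>)) sequentially"
      by (simp add: numeral_2_eq_2)
    then have "\<forall>\<^sub>F n in sequentially. \<forall>x\<in>UNIV. dist (deriv (deriv (\<phi>s n)) x) (deriv (deriv \<phi>) x) < 1"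
      by (rule uniform_limitD) simp
    then obtain N where N: "\<And>n x. n \<ge> N \<Longrightarrow> \<bar>deriv (deriv (\<phi>s n)) x - deriv (deriv \<phi>) x\<bar> < 1"
      by (auto simp: eventually_sequentially dist_real_def)
    \<comment> \<open>From index \<open>N\<close> on, the second derivatives are bounded by
      \<open>\<bar>deriv (deriv \<phi>) x\<bar> + 1\<close> on \<open>K\<close> and vanish off
      \<open>K\<close>, so \<open>?w\<close> dominates. This is why the sequence is shifted by
      \<open>N\<close> before the limit is taken.\<close>
    let ?w = "\<lambda>x. \<bar>f x * deriv (deriv \<phi>) x\<bar> + \<bar>indicator K x * f x\<bar>"
    have "integrable lebesgue (\<lambda>x. indicator K x * f x)"
      using f K(1) by (simp add: locally_integrable_def set_integrable_def)
    then have w: "integrable lebesgue ?w"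
      using int[OF \<phi>] by (intro Bochner_Integration.integrable_add integrable_abs)
    have tail: "(\<lambda>n. LINT x|lebesgue. f x * deriv (deriv (\<phi>s (n + N))) x) \<longlonglongrightarrow>
        (LINT x|lebesgue. f x * deriv (deriv \<phi>) x)"
    proof (rule integral_dominated_convergence[OF _ _ w])
      show "(\<lambda>x. f x * deriv (deriv \<phi>) x) \<in> borel_measurable lebesgue"
        using int[OF \<phi>] by simp
      show "(\<lambda>x. f x * deriv (deriv (\<phi>s (n + N))) x) \<in> borel_measurable lebesgue" for n
        using int[of "\<phi>s (n + N)"] \<phi>s by simp
      have "(\<lambda>n. deriv (deriv (\<phi>s (n + N))) x) \<longlonglongrightarrow> deriv (deriv \<phi>) x" for x
        by (rule LIMSEQ_ignore_initial_segment[OF tendsto_uniform_limitI[OF ul]]) simp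
      then show "AE x in lebesgue. (\<lambda>n. f x * deriv (deriv (\<phi>s (n + N))) x) \<longlonglongrightarrow> f x * deriv (deriv \<phi>) x"
        by (intro AE_I2 tendsto_mult tendsto_const)
      show "AE x in lebesgue. norm (f x * deriv (deriv (\<phi>s (n + N))) x) \<le> ?w x" for n
      proof (rule AE_I2)
        fix x
        show "norm (f x * deriv (deriv (\<phi>s (n + N))) x) \<le> ?w x"
        proof (cases "x \<in> K")
          case True
          have "\<bar>deriv (deriv (\<phi>s (n + N))) x\<bar> \<le> \<bar>deriv (deriv \<phi>) x\<bar> + 1"
            using N[of "n + N" x] by simp
          then have "\<bar>f x\<bar> * \<bar>deriv (deriv (\<phi>s (n + N))) x\<bar> \<le> \<bar>f x\<bar> * (\<bar>deriv (deriv \<phi>) x\<bar> + 1)"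
            by (rule mult_left_mono) simp
          with True show ?thesis
            by (simp add: abs_mult distrib_left)
        next
          case False
          with zero show ?thesis by simp
        qed
      qed
    qed
    show ?thesis
      unfolding second_dist_deriv_def regular_distribution_def
      using tail by (rule LIMSEQ_offset)
  qed
qed

section \<open>Folding the pairing at the base point\<close>

text \<open>The interval is split at \<open>c\<close>, both halves are translated to the origin, and
  the left half is reflected. It serves twice: at \<open>x0\<close> for the pairing and at 0 for the
  integral of an even test function.\<close>

lemma has_integral_fold:
  fixes F :: "real \<Rightarrow> real"
  assumes I: "(F has_integral I) UNIV" and 0: "\<And>x. x \<notin> {c - d..c + d} \<Longrightarrow> F x = 0" and d: "d \<ge> 0"
  shows "((\<lambda>t. F (c + t) + F (c - t)) has_integral I) {0..d}"
proof -
  have Icc: "(F has_integral I) {c - d..c + d}"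
  proof -
    have "(\<lambda>x. if x \<in> {c - d..c + d} then F x else 0) = F"
      using 0 by (intro ext) (simp del: atLeastAtMost_iff)
    then show ?thesis
      using I has_integral_restrict_UNIV[of "{c - d..c + d}" F I] by (simp only:)
  qed
  then have int: "F integrable_on {c - d..c + d}"
    by blast
  have L: "F integrable_on {c - d..c}" and R: "F integrable_on {c..c + d}"
    using d by (auto intro: integrable_on_subinterval[OF int])
  have sum: "integral {c - d..c} F + integral {c..c + d} F = I"
    using Henstock_Kurzweil_Integration.integral_combine[of "c - d" c "c + d" F] int Icc d
    by (simp add: integral_unique)
  have R': "((\<lambda>t. F (c + t)) has_integral integral {c..c + d} F) {0..d}"
    using has_integral_shift_real_ivl[OF integrable_integral[OF R], of c] by (simp add: add.commute)
  have "((\<lambda>t. F (t + c)) has_integral integral {c - d..c} F) {- d..0}"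
    using has_integral_shift_real_ivl[OF integrable_integral[OF L], of c] by simp
  then have "((\<lambda>t. F (- t + c)) has_integral integral {c - d..c} F) {0..d}"
    by (subst (asm) has_integral_reflect_real[symmetric]) simp
  then have "((\<lambda>t. F (c - t)) has_integral integral {c - d..c} F) {0..d}"
    by (simp add: add.commute)
  from has_integral_add[OF R' this] sum show ?thesis
    by (simp add: add.commute)
qed

section \<open>Integrals and Lipschitz bounds for test functions and their derivatives\<close>

lemma has_integral_deriv_test_function:
  assumes "\<phi> \<in> \<D>" "a \<le> b"
  shows "(deriv \<phi> has_integral (\<phi> b - \<phi> a)) {a..b}"
  using test_function_DERIV[OF assms(1)]
  by (intro fundamental_theorem_of_calculus assms(2))
     (auto simp: has_real_derivative_iff_has_vector_derivative[symmetric] intro: has_field_derivative_at_within)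

text \<open>Two integrations by parts in one step: \<open>?P\<close> is an antiderivative of the
  difference of the integrands and vanishes at both ends.\<close>

lemma integral_square_mult_second_deriv:
  assumes \<phi>: "\<phi> \<in> \<D>" and R: "R \<ge> 0" "\<phi> R = 0" "deriv \<phi> R = 0"
  shows "integral {0..R} (\<lambda>s. s\<^sup>2 * deriv (deriv \<phi>) s) = 2 * integral {0..R} \<phi>"
proof -
  note D = test_function_DERIV[OF \<phi>] test_function_DERIV[OF deriv_test_function[OF \<phi>]]
  let ?P = "\<lambda>s. s\<^sup>2 * deriv \<phi> s - 2 * s * \<phi> s"
  have "(?P has_real_derivative s\<^sup>2 * deriv (deriv \<phi>) s - 2 * \<phi> s) (at s)" for s
    by (rule derivative_eq_intros D refl)+ (simp add: algebra_simps)
  then have 1: "((\<lambda>s. s\<^sup>2 * deriv (deriv \<phi>) s - 2 * \<phi> s) has_integral (?P R - ?P 0)) {0..R}"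
    using R(1) by (intro fundamental_theorem_of_calculus)
     (auto simp: has_real_derivative_iff_has_vector_derivative[symmetric] intro: has_field_derivative_at_within)
  have "(\<phi> has_integral integral {0..R} \<phi>) {0..R}"
    using integrable_continuous_real[OF continuous_on_test_function[OF \<phi>]] by (rule integrable_integral)
  then have 2: "((\<lambda>s. 2 * \<phi> s) has_integral 2 * integral {0..R} \<phi>) {0..R}"
    by (rule has_integral_mult_right)
  from has_integral_add[OF 1 2] show ?thesis
    using R by (simp add: integral_unique)
qed

text \<open>The derivative is continuous, hence bounded on the compact interval. With
  \<open>\<psi>\<close> a second derivative this is the weight in the averaging argument.\<close>

lemma lipschitz_square_mult_test_function:
  assumes \<psi>: "\<psi> \<in> \<D>"
  obtains L where "L-lipschitz_on {0..R} (\<lambda>s. s\<^sup>2 * \<psi> s)"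
proof -
  let ?k' = "\<lambda>s. 2 * s * \<psi> s + s\<^sup>2 * deriv \<psi> s"
  have D: "((\<lambda>s. s\<^sup>2 * \<psi> s) has_real_derivative ?k' s) (at s)" for s
    by (rule derivative_eq_intros test_function_DERIV[OF \<psi>] refl)+ (simp add: algebra_simps)
  have "continuous_on {0..R} ?k'"
    by (intro continuous_intros continuous_on_test_function \<psi> deriv_test_function)
  then have "bounded (?k' ` {0..R})"
    by (intro compact_imp_bounded compact_continuous_image) auto
  then obtain L where L: "L > 0" "\<And>s. s \<in> {0..R} \<Longrightarrow> norm (?k' s) \<le> L"
    unfolding bounded_pos by blast
  have "L-lipschitz_on {0..R} (\<lambda>s. s\<^sup>2 * \<psi> s)"
  proof (rule lipschitz_onI)
    show "dist (x\<^sup>2 * \<psi> x) (y\<^sup>2 * \<psi> y) \<le> L * dist x y" if "x \<in> {0..R}" "y \<in> {0..R}" for x y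
      unfolding dist_norm
      by (rule field_differentiable_bound[of "{0..R}" "\<lambda>s. s\<^sup>2 * \<psi> s" ?k'])
         (use that L(2) D in \<open>auto intro: has_field_derivative_at_within\<close>)
  qed (use L in simp)
  then show ?thesis by (rule that)
qed

text \<open>After folding at \<open>x0\<close>, evenness of the weight \<open>w\<close> brings out
  \<open>f (x0 + t) + f (x0 - t)\<close>. The missing \<open>- 2 * f x0\<close> is free because
  \<open>w\<close> has integral 0 over \<open>{0..R * \<epsilon>}\<close>, and multiplying and
  dividing by the square of \<open>t\<close> exposes the quotient.\<close>

lemma pairing_eq_integral_symmetric_quotient2:
  assumes f: "locally_integrable f" and \<phi>: "\<phi> \<in> \<D>" and even: "\<And>u. \<phi> (- u) = \<phi> u"
    and R: "R > 0" "\<And>x. \<bar>x\<bar> \<ge> R \<Longrightarrow> deriv \<phi> x = 0" "\<And>x. \<bar>x\<bar> \<ge> R \<Longrightarrow> deriv (deriv \<phi>) x = 0"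
    and \<epsilon>: "\<epsilon> > 0"
  shows "second_dist_deriv (regular_distribution f) (rescale \<phi> x0 \<epsilon>) =
    integral {0..R * \<epsilon>} (\<lambda>t. symmetric_quotient2 f x0 t * ((t / \<epsilon>)\<^sup>2 * deriv (deriv \<phi>) (t / \<epsilon>))) / \<epsilon>"
proof -
  note \<phi>' = deriv_test_function[OF \<phi>]
  note \<phi>'' = deriv_test_function[OF \<phi>']
  define w where "w = (\<lambda>t. inverse \<epsilon> ^ 3 * deriv (deriv \<phi>) (t / \<epsilon>))"
  define F where "F = (\<lambda>x. f x * w (x - x0))"
  have odd: "deriv \<phi> (- u) = (- 1) * deriv \<phi> u" for u
    using deriv_minus_arg[of \<phi> 1] test_function_DERIV[OF \<phi>] even by simp
  have "deriv (deriv \<phi>) (- u) = deriv (deriv \<phi>) u" for u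
    using deriv_minus_arg[OF test_function_DERIV[OF \<phi>'] odd] by simp
  then have w_even: "w (- t) = w t" for t
    by (simp add: w_def)
  have w0: "w t = 0" if "\<bar>t\<bar> \<ge> R * \<epsilon>" for t
    using that \<epsilon> by (simp add: w_def R field_simps)
  have F0: "F x = 0" if "x \<notin> {x0 - R * \<epsilon>..x0 + R * \<epsilon>}" for x
    using that by (auto simp: F_def intro!: w0)
  have "integrable lebesgue F"
    unfolding F_def
  proof (rule integrable_mult_continuous_compact_support[OF f, of "{x0 - R * \<epsilon>..x0 + R * \<epsilon>}"])
    show "continuous_on UNIV (\<lambda>x. w (x - x0))"
      unfolding w_def using \<epsilon>
      by (intro continuous_intros continuous_on_compose2[OF continuous_on_test_function[OF \<phi>'', of UNIV]]) auto
  qed (auto intro!: w0)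
  then have "(F has_integral (LINT x|lebesgue. F x)) UNIV"
    by (rule has_integral_integral_lebesgue)
  then have *: "((\<lambda>t. F (x0 + t) + F (x0 - t)) has_integral (LINT x|lebesgue. F x)) {0..R * \<epsilon>}"
    using R(1) \<epsilon> F0 by (intro has_integral_fold) auto
  \<comment> \<open>The integral of the second derivative over \<open>{0..R}\<close> is
    \<open>deriv \<phi> R - deriv \<phi> 0\<close>: the first term vanishes by the support
    condition, the second because \<open>deriv \<phi>\<close> is odd.\<close>
  have "((\<lambda>t. deriv (deriv \<phi>) (t / \<epsilon>)) has_integral 0) {0..R * \<epsilon>}"
    using has_integral_affinity'[of "deriv (deriv \<phi>)" 0 0 R "inverse \<epsilon>" 0]
      has_integral_deriv_test_function[OF \<phi>', of 0 R] R odd[of 0] \<epsilon>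
    by (simp add: field_simps)
  then have "((\<lambda>t. 2 * f x0 * inverse \<epsilon> ^ 3 * deriv (deriv \<phi>) (t / \<epsilon>)) has_integral (2 * f x0 * inverse \<epsilon> ^ 3 * 0)) {0..R * \<epsilon>}"
    by (rule has_integral_mult_right)
  then have "((\<lambda>t. 2 * f x0 * w t) has_integral 0) {0..R * \<epsilon>}"
    by (simp add: w_def mult.assoc)
  from has_integral_diff[OF * this]
  have "((\<lambda>t. F (x0 + t) + F (x0 - t) - 2 * f x0 * w t) has_integral (LINT x|lebesgue. F x)) {0..R * \<epsilon>}"
    by simp
  moreover have "F (x0 + t) + F (x0 - t) - 2 * f x0 * w t =
      symmetric_quotient2 f x0 t * ((t / \<epsilon>)\<^sup>2 * deriv (deriv \<phi>) (t / \<epsilon>)) / \<epsilon>" for t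
  \<comment> \<open>At \<open>t = 0\<close> the quotient cannot be cleared of its denominator, but
    both sides are 0, so the identity holds at every point.\<close>
  proof (cases "t = 0")
    case True
    then show ?thesis by (simp add: F_def)
  next
    case False
    then have "symmetric_quotient2 f x0 t * ((t / \<epsilon>)\<^sup>2 * deriv (deriv \<phi>) (t / \<epsilon>)) / \<epsilon> =
        (f (x0 + t) + f (x0 - t) - 2 * f x0) * w t"
      using \<epsilon> by (simp add: symmetric_quotient2_def w_def power2_eq_square power3_eq_cube field_simps)
    then show ?thesis
      using w_even[of t] by (simp add: F_def algebra_simps)
  qed
  ultimately have "integral {0..R * \<epsilon>}
      (\<lambda>t. symmetric_quotient2 f x0 t * ((t / \<epsilon>)\<^sup>2 * deriv (deriv \<phi>) (t / \<epsilon>)) / \<epsilon>) = (LINT x|lebesgue. F x)"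
    by (simp only: integral_unique)
  moreover have "second_dist_deriv (regular_distribution f) (rescale \<phi> x0 \<epsilon>) = (LINT x|lebesgue. F x)"
    by (simp add: second_dist_deriv_def regular_distribution_def deriv_deriv_rescale[OF \<phi>] F_def w_def)
  ultimately show ?thesis
    by simp
qed

lemma integral_even_test_function:
  assumes \<phi>: "\<phi> \<in> \<D>" and even: "\<And>u. \<phi> (- u) = \<phi> u"
    and R: "R > 0" "\<And>x. \<bar>x\<bar> \<ge> R \<Longrightarrow> \<phi> x = 0"
  shows "(LINT u|lebesgue. \<phi> u) = 2 * integral {0..R} \<phi>"
proof -
  \<comment> \<open>Taking the constant 1 for \<open>f\<close> makes integrability of
    \<open>\<phi>\<close> an instance of the product lemma.\<close>
  have "locally_integrable (\<lambda>_. 1)"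
    unfolding locally_integrable_def set_integrable_def
    using lmeasurable_compact
    by (auto simp: fmeasurable_def simp del: emeasure_completion intro!: integrable_real_indicator)
  then have "integrable lebesgue \<phi>"
    using integrable_mult_test_function[OF _ \<phi>] by fastforce
  then have "(\<phi> has_integral (LINT u|lebesgue. \<phi> u)) UNIV"
    by (rule has_integral_integral_lebesgue)
  then have "((\<lambda>t. \<phi> (0 + t) + \<phi> (0 - t)) has_integral (LINT u|lebesgue. \<phi> u)) {0..R}"
    using R by (intro has_integral_fold) auto
  then have "((\<lambda>t. 2 * \<phi> t) has_integral (LINT u|lebesgue. \<phi> u)) {0..R}"
    by (simp add: even)
  then show ?thesis
    by (simp add: integral_unique flip: integral_mult_right)
qed

section \<open>Passage to the limit\<close>

lemma has_SBD2_averages: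
  assumes "has_SBD2 f M x0"
  shows "\<forall>\<^sub>F h in at_right 0. symmetric_quotient2 f x0 integrable_on {0..h}"
    and "((\<lambda>h. integral {0..h} (symmetric_quotient2 f x0) / h) \<longlongrightarrow> M) (at_right 0)"
proof -
  have int: "\<forall>\<^sub>F h in at_right 0. set_integrable lebesgue {0<..<h} (symmetric_quotient2 f x0)"
    and lim: "((\<lambda>h. (1 / h) * (LINT t:{0<..<h}|lebesgue. symmetric_quotient2 f x0 t)) \<longlongrightarrow> M) (at_right 0)"
    using assms by (auto simp: has_SBD2_def)
  \<comment> \<open>The Lebesgue integral over the open interval becomes a gauge integral over the
    closed one; the two added endpoints are negligible.\<close>
  have I: "(symmetric_quotient2 f x0 has_integral (LINT t:{0<..<h}|lebesgue. symmetric_quotient2 f x0 t)) {0..h}"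
    if "set_integrable lebesgue {0<..<h} (symmetric_quotient2 f x0)" for h
    using has_integral_set_lebesgue[OF that] by (simp only: has_integral_Icc_iff_Ioo)
  show "\<forall>\<^sub>F h in at_right 0. symmetric_quotient2 f x0 integrable_on {0..h}"
    using int by (rule eventually_mono) (rule has_integral_integrable[OF I])
  have "\<forall>\<^sub>F h in at_right 0. (1 / h) * (LINT t:{0<..<h}|lebesgue. symmetric_quotient2 f x0 t) =
      integral {0..h} (symmetric_quotient2 f x0) / h"
    using int by (rule eventually_mono) (simp add: integral_unique[OF I])
  with lim show "((\<lambda>h. integral {0..h} (symmetric_quotient2 f x0) / h) \<longlongrightarrow> M) (at_right 0)"
    by (rule Lim_transform_eventually)
qed

theorem theorem3p14:
  fixes f :: "real \<Rightarrow> real" and x0 M :: real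
  assumes "locally_integrable f"
    and "has_SBD2 f M x0"
  shows "(\<forall>\<phi>\<in>\<D>. (\<forall>u. \<phi> (- u) = \<phi> u) \<longrightarrow>
            ((\<lambda>\<epsilon>. second_dist_deriv (regular_distribution f) (rescale \<phi> x0 \<epsilon>))
               \<longlongrightarrow> M * (LINT u|lebesgue. \<phi> u)) (at_right 0)) \<and>
         has_symmetric_point_value (second_dist_deriv (regular_distribution f)) M x0"
proof -
  have main: "((\<lambda>\<epsilon>. second_dist_deriv (regular_distribution f) (rescale \<phi> x0 \<epsilon>))
      \<longlongrightarrow> M * (LINT u|lebesgue. \<phi> u)) (at_right 0)"
    if \<phi>: "\<phi> \<in> \<D>" and even: "\<And>u. \<phi> (- u) = \<phi> u" for \<phi>
  proof -
    obtain R0 where R0: "R0 > 0" "\<And>x. x \<notin> {-R0..R0} \<Longrightarrow> \<phi> x = 0"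
      using test_function_bounded_support[OF \<phi>] by blast
    have R0': "\<And>x. x \<notin> {-R0..R0} \<Longrightarrow> deriv \<phi> x = 0"
      using R0(2) by (rule deriv_eq_0_outside_closed[OF closed_atLeastAtMost])
    have R0'': "\<And>x. x \<notin> {-R0..R0} \<Longrightarrow> deriv (deriv \<phi>) x = 0"
      using R0' by (rule deriv_eq_0_outside_closed[OF closed_atLeastAtMost])
    \<comment> \<open>Vanishing is known only strictly outside \<open>{-R0..R0}\<close>; the extra 1
      makes \<open>\<phi>\<close> and its first two derivatives vanish at \<open>R\<close> itself,
      as the boundary terms require.\<close>
    define R where "R = R0 + 1"
    have R: "R > 0" "\<And>x. \<bar>x\<bar> \<ge> R \<Longrightarrow> \<phi> x = 0" "\<And>x. \<bar>x\<bar> \<ge> R \<Longrightarrow> deriv \<phi> x = 0"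
      "\<And>x. \<bar>x\<bar> \<ge> R \<Longrightarrow> deriv (deriv \<phi>) x = 0"
    proof -
      have out: "x \<notin> {-R0..R0}" if "\<bar>x\<bar> \<ge> R" for x
        using that by (auto simp: R_def)
      show "R > 0"
        using R0(1) by (simp add: R_def)
      show "\<phi> x = 0" "deriv \<phi> x = 0" "deriv (deriv \<phi>) x = 0" if "\<bar>x\<bar> \<ge> R" for x
        using out[OF that] by (simp_all only: R0(2) R0' R0'' not_False_eq_True)
    qed
    let ?k = "\<lambda>s. s\<^sup>2 * deriv (deriv \<phi>) s"
    obtain L where L: "L-lipschitz_on {0..R} ?k"
      using lipschitz_square_mult_test_function[OF deriv_test_function[OF deriv_test_function[OF \<phi>]]] by blast
    have "((\<lambda>\<epsilon>. integral {0..R * \<epsilon>} (\<lambda>t. symmetric_quotient2 f x0 t * ?k (t / \<epsilon>)) / \<epsilon>)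
        \<longlongrightarrow> M * integral {0..R} ?k) (at_right 0)"
      by (rule tendsto_integral_lipschitz_weight[OF has_SBD2_averages[OF assms(2)] L R(1)])
    \<comment> \<open>The factor 2 from integration by parts is exactly what evenness needs to pass
      from \<open>{0..R}\<close> to the whole line.\<close>
    moreover have "integral {0..R} ?k = (LINT u|lebesgue. \<phi> u)"
      using integral_square_mult_second_deriv[OF \<phi>, of R] integral_even_test_function[OF \<phi> even R(1,2)] R
      by simp
    moreover have "\<forall>\<^sub>F \<epsilon> in at_right 0.
        integral {0..R * \<epsilon>} (\<lambda>t. symmetric_quotient2 f x0 t * ?k (t / \<epsilon>)) / \<epsilon> =
        second_dist_deriv (regular_distribution f) (rescale \<phi> x0 \<epsilon>)"
      using eventually_at_right_less[of 0]
      by eventually_elim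
        (rule pairing_eq_integral_symmetric_quotient2[OF assms(1) \<phi> even R(1,3,4), symmetric])
    ultimately show ?thesis
      using Lim_transform_eventually by fastforce
  qed
  then show ?thesis
    using distribution_second_dist_deriv_regular[OF assms(1)]
    by (simp add: has_symmetric_point_value_def)
qed

end
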